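(* For $|q|<1$, $$\sum_{m,k\geq0}\frac{q^{2T(k)+2T(m+k)}}{(q)_m(q)_{2k+1}}(-q;q^2)_k=\frac{(q^{20},q^6,q^{14};q^{20})_\infty}{(q)_\infty}.$$
   Context: For $m$ a nonnegative integer, $(a;q)_m=\prod_{j=0}^{m-1}(1-aq^j)$ (with $(a;q)_0=1$), $(a;q)_\infty=\prod_{j\ge0}(1-aq^j)$, and $(a_1,\ldots,a_r;q)_\infty=(a_1;q)_\infty\cdots(a_r;q)_\infty$. In particular $(q)_m=(q;q)_m=\prod_{j=1}^m(1-q^j)$, $(q)_\infty=(q;q)_\infty$, and $(-q;q^2)_m=\prod_{j=0}^{m-1}(1+q^{2j+1})$. $T(j)=\frac{j(j+1)}{2}$. *)

theory Defs
  imports "HOL-Analysis.Analysis"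
begin

definition qpoch :: "complex \<Rightarrow> complex \<Rightarrow> nat \<Rightarrow> complex" where
  "qpoch a q m = (\<Prod>j<m. 1 - a * q ^ j)"

(* For norm q < 1 the product converges for every a, in the library's sense
   of prodinf, which also allows finitely many vanishing factors. *)
definition qpoch_inf :: "complex \<Rightarrow> complex \<Rightarrow> complex" where
  "qpoch_inf a q = (\<Prod>j. 1 - a * q ^ j)"

definition qpoch_inf_list :: "complex list \<Rightarrow> complex \<Rightarrow> complex" where
  "qpoch_inf_list as q = (\<Prod>a\<leftarrow>as. qpoch_inf a q)"

definition T :: "nat \<Rightarrow> nat" where
  "T j = j * (j + 1) div 2"

end

(* A two-fold application of Bailey's lemma. Specialising the finite Jacobi triple product at
   z = i sqrt q and z = - i sqrt q and averaging gives
     (-q; q^2)_k / (q)_{2k+1} = Sum_{r <= k} A_r / ((q)_{k-r} (q)_{k+r+1}),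
   where A_{2j} = (-1)^j q^{2j^2} and A_{2j-1} = (-1)^j q^{2j^2}. Inserting this into the double
   series yields an absolutely convergent triple series in m, r and s = k - r. For fixed r, the sums
   over s (with n = m + s fixed) and then over n are evaluated by the q-Vandermonde identity
     Sum_s q^{s(s+a)} / ((q)_{n-s} (q)_s (q)_{s+a}) = 1 / ((q)_n (q)_{n+a})
   and its limit as n tends to infinity, with a = 2r + 1. What remains is
   (1 / (q)_inf) Sum_r A_r q^{2r(r+1)}, a theta series that the Jacobi triple product with base q^20
   and z = q^6 evaluates. *)

theory Submission
  imports Defs
begin

section \<open>Finite identities\<close>

lemma two_T: "2 * T n = n * (n + 1)"
  unfolding T_def by simp

lemma T_0 [simp]: "T 0 = 0"
  by (simp add: T_def)

lemma T_Suc [simp]: "T (Suc n) = T n + Suc n"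
  using two_T[of n] two_T[of "Suc n"] by simp

lemma T_ge: "n \<le> T n"
  by (induction n) auto

lemma qpoch_0 [simp]: "qpoch a q 0 = 1"
  by (simp add: qpoch_def)

lemma qpoch_Suc [simp]: "qpoch a q (Suc n) = qpoch a q n * (1 - a * q ^ n)"
  by (simp add: qpoch_def)

lemma power_neq_1:
  fixes q :: complex
  assumes "norm q < 1" "n > 0"
  shows "q ^ n \<noteq> 1"
proof
  assume "q ^ n = 1"
  then have "norm q ^ n = 1" by (metis norm_one norm_power)
  moreover have "norm q ^ n < 1"
    using assms by (simp add: power_less_one_iff)
  ultimately show False by simp
qed

lemma qpoch_neq_0:
  assumes "norm q < 1"
  shows "qpoch q q n \<noteq> 0"
  using power_neq_1[OF assms, of "Suc _"] by (simp add: qpoch_def)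

section \<open>Gaussian binomial coefficients and the q-binomial theorem\<close>

text \<open>The Gaussian binomial coefficient. The guard matters because \<open>n - k\<close>
  truncates: the value 0 for k > n makes Pascal's rule hold at the boundary and makes sums over k
  terminate.\<close>

definition qbinom :: "complex \<Rightarrow> nat \<Rightarrow> nat \<Rightarrow> complex" where
  "qbinom q n k = (if k \<le> n then qpoch q q n / (qpoch q q k * qpoch q q (n - k)) else 0)"

lemma qbinom_symmetric: "k \<le> n \<Longrightarrow> qbinom q n (n - k) = qbinom q n k"
  by (simp add: qbinom_def mult.commute)

lemma qbinom_0 [simp]: "norm q < 1 \<Longrightarrow> qbinom q n 0 = 1"
  by (simp add: qbinom_def qpoch_neq_0)

lemma qbinom_self [simp]: "norm q < 1 \<Longrightarrow> qbinom q n n = 1"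
  by (simp add: qbinom_def qpoch_neq_0)

lemma qbinom_eq_0 [simp]: "n < k \<Longrightarrow> qbinom q n k = 0"
  by (simp add: qbinom_def)

text \<open>For k < n, after common factors are removed, this is 1 - q^(n+1) = q^(k+1) (1 - q^(n-k))
  + (1 - q^(k+1)).\<close>

lemma qbinom_Suc_Suc:
  assumes "norm q < 1"
  shows "qbinom q (Suc n) (Suc k) = q ^ Suc k * qbinom q n (Suc k) + qbinom q n k"
proof -
  consider "k < n" | "k = n" | "k > n" by linarith
  then show ?thesis
  proof cases
    case 1
    then obtain d where n: "n = Suc (k + d)"
      using less_iff_Suc_add by auto
    have nz: "qpoch q q k \<noteq> 0" "qpoch q q d \<noteq> 0" "1 - q * q ^ k \<noteq> 0" "1 - q * q ^ d \<noteq> 0"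
      using qpoch_neq_0[OF assms] power_neq_1[OF assms, of "Suc _"] by auto
    have e: "Suc k \<le> n" "k \<le> n" "Suc n - Suc k = Suc d" "n - Suc k = d" "n - k = Suc d"
      using n by auto
    show ?thesis
      unfolding qbinom_def e n using nz
      by (simp add: divide_simps) (simp add: algebra_simps power_add)
  qed (use assms in auto)
qed

text \<open>The other q-Pascal rule, obtained from the first by reflecting the lower index.\<close>

lemma qbinom_Suc_Suc':
  assumes "norm q < 1" "k \<le> n"
  shows "qbinom q (Suc n) (Suc k) = qbinom q n (Suc k) + q ^ (n - k) * qbinom q n k"
proof (cases "k = n")
  case False
  then have "qbinom q (Suc n) (Suc k) = qbinom q (Suc n) (Suc (n - Suc k))"
    using assms(2) qbinom_symmetric[of "Suc k" "Suc n" q] by (simp add: Suc_diff_Suc)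
  also have "\<dots> = q ^ (n - k) * qbinom q n (n - k) + qbinom q n (n - Suc k)"
    using qbinom_Suc_Suc[OF assms(1), of n "n - Suc k"] False assms(2)
    by (simp add: Suc_diff_Suc)
  finally show ?thesis
    using False assms(2) by (simp add: qbinom_symmetric)
qed (use assms in auto)

text \<open>Rothe's finite q-binomial theorem. The second Pascal rule splits off the last factor 1 -
  x q^(n+1).\<close>

theorem q_binomial:
  assumes "norm q < 1"
  shows "(\<Sum>k\<le>n. (- x) ^ k * q ^ T k * qbinom q n k) = qpoch (x * q) q n"
proof (induction n)
  case 0
  show ?case using assms by simp
next
  case (Suc n)
  let ?f = "\<lambda>n k. (- x) ^ k * q ^ T k * qbinom q n k"
  have "(\<Sum>k\<le>n. ?f (Suc n) (Suc k)) = (\<Sum>k\<le>n. ?f n (Suc k) - x * q ^ Suc n * ?f n k)"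
  proof (rule sum.cong)
    fix k assume "k \<in> {..n}"
    then have k: "k \<le> n" by simp
    \<comment> \<open>The exponents satisfy T (k + 1) + (n - k) = T k + (n + 1), so the factor
      q^(n+1) no longer depends on k.\<close>
    then have "q ^ k * q ^ (n - k) = q ^ n"
      by (metis le_add_diff_inverse power_add)
    then have e: "q ^ T (Suc k) * q ^ (n - k) = q ^ T k * q ^ Suc n"
      by (simp add: power_add)
    have "?f (Suc n) (Suc k)
        = ?f n (Suc k) + (- x) ^ Suc k * (q ^ T (Suc k) * q ^ (n - k)) * qbinom q n k"
      unfolding qbinom_Suc_Suc'[OF assms k] by (simp add: algebra_simps)
    then show "?f (Suc n) (Suc k) = ?f n (Suc k) - x * q ^ Suc n * ?f n k"
      unfolding e by (simp add: algebra_simps)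
  qed simp
  then have "(\<Sum>k\<le>Suc n. ?f (Suc n) k)
      = ?f n 0 + (\<Sum>k\<le>n. ?f n (Suc k)) - x * q ^ Suc n * (\<Sum>k\<le>n. ?f n k)"
    using assms by (simp add: sum.atMost_Suc_shift sum_subtractf sum_distrib_left del: sum.atMost_Suc T_Suc)
  also have "?f n 0 + (\<Sum>k\<le>n. ?f n (Suc k)) = (\<Sum>k\<le>Suc n. ?f n k)"
    by (simp add: sum.atMost_Suc_shift del: sum.atMost_Suc T_Suc)
  also have "\<dots> = (\<Sum>k\<le>n. ?f n k)" by simp
  finally show ?case using Suc by (simp add: algebra_simps)
qed

section \<open>The finite Jacobi triple product\<close>

lemma prod_lessThan_add:
  fixes f :: "nat \<Rightarrow> 'a :: comm_monoid_mult"
  shows "(\<Prod>k<m + n. f k) = (\<Prod>k<m. f k) * (\<Prod>k<n. f (m + k))"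
  by (induction n) (simp_all add: mult.assoc)

lemma sum_lessThan_add:
  fixes f :: "nat \<Rightarrow> 'a :: comm_monoid_add"
  shows "(\<Sum>k<m + n. f k) = (\<Sum>k<m. f k) + (\<Sum>k<n. f (m + k))"
  by (induction n) (simp_all add: add.assoc)

lemma sum_fold_odd:
  fixes f :: "nat \<Rightarrow> 'a :: comm_monoid_add"
  shows "(\<Sum>k\<le>2 * n + 1. f k) = (\<Sum>r\<le>n. f (n - r) + f (n + 1 + r))"
proof -
  have "(\<Sum>k\<le>2 * n + 1. f k) = (\<Sum>k<Suc n + Suc n. f k)"
    by (simp flip: lessThan_Suc_atMost add: mult_2)
  also have "\<dots> = (\<Sum>k<Suc n. f k) + (\<Sum>k<Suc n. f (Suc n + k))"
    by (rule sum_lessThan_add)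
  also have "(\<Sum>k<Suc n. f k) = (\<Sum>k<Suc n. f (n - k))"
    by (subst sum.nat_diff_reindex[symmetric]) simp
  finally show ?thesis
    by (simp add: sum.distrib lessThan_Suc_atMost add_ac)
qed

text \<open>Each factor with a negative power of q is turned around: 1 - z/q^j = (-z/q^j) (1 -
  q^j/z), and the exponents j = 1, ..., n add up to T n.\<close>

lemma qpoch_reverse:
  assumes "q \<noteq> 0" "z \<noteq> 0"
  shows "(\<Prod>i<n. 1 - z * q ^ i / q ^ n) = (- z) ^ n / q ^ T n * qpoch (q / z) q n"
proof (induction n)
  case (Suc n)
  have "(\<Prod>i<Suc n. 1 - z * q ^ i / q ^ Suc n) = (1 - z / q ^ Suc n) * (\<Prod>i<n. 1 - z * q ^ i / q ^ n)"
    using assms by (simp add: prod.lessThan_Suc_shift del: prod.lessThan_Suc)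
  also have "\<dots> = (1 - z / q ^ Suc n) * ((- z) ^ n / q ^ T n * qpoch (q / z) q n)"
    unfolding Suc ..
  also have "\<dots> = (- z) ^ Suc n / q ^ T (Suc n) * qpoch (q / z) q (Suc n)"
    using assms by (simp add: field_simps power_add)
  finally show ?case .
qed simp

text \<open>The bilateral sum over the exponents \<open>-n, \<dots>, n + 1\<close> of \<open>z\<close>, with the exponents
  \<open>-r\<close> and \<open>r + 1\<close> paired because their coefficients agree up to sign.\<close>

theorem finite_triple_product:
  assumes "norm q < 1" "q \<noteq> 0" "z \<noteq> 0"
  shows "qpoch z q (n + 1) * qpoch (q / z) q n
    = (\<Sum>r\<le>n. (- 1) ^ r * q ^ T r * qbinom q (2 * n + 1) (n - r) * (1 / z ^ r - z ^ (r + 1)))"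
proof -
  \<comment> \<open>With x = z/q^(n+1), the 2n+1 factors of the q-binomial theorem run over z
    q^(-n), ..., z q^n, symmetric about z.\<close>
  define f where "f k = (- (z / q ^ (n + 1))) ^ k * q ^ T k * qbinom q (2 * n + 1) k" for k
  have fold: "f (n - r) + f (n + 1 + r) = (- z) ^ n / q ^ T n *
      ((- 1) ^ r * q ^ T r * qbinom q (2 * n + 1) (n - r) * (1 / z ^ r - z ^ (r + 1)))"
    if r: "r \<le> n" for r
  proof -
    obtain d where n: "n = d + r" using r by (metis le_add_diff_inverse2)
    \<comment> \<open>For k = n - r and for k = n + 1 + r alike, T k - (n+1) k = T r - T n.
      \<open>A\<close> and \<open>B\<close> state this without subtracting exponents.\<close>
    have A: "T n + T (n - r) = T r + (n + 1) * (n - r)"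
      using two_T[of n] two_T[of r] two_T[of "n - r"] by (simp add: n algebra_simps)
    have B: "T n + T (n + 1 + r) = T r + (n + 1) * (n + 1 + r)"
      using two_T[of n] two_T[of r] two_T[of "n + 1 + r"] by (simp add: algebra_simps)
    have s: "qbinom q (2 * n + 1) (n + 1 + r) = qbinom q (2 * n + 1) (n - r)"
    proof -
      have "2 * n + 1 - (n - r) = n + 1 + r" using r by simp
      then show ?thesis using qbinom_symmetric[of "n - r" "2 * n + 1" q] by simp
    qed
    have "q ^ T n * q ^ T (n - r) = q ^ T r * q ^ ((n + 1) * (n - r))"
      by (simp only: A flip: power_add)
    then have A': "q ^ T (n - r) / q ^ ((n + 1) * (n - r)) = q ^ T r / q ^ T n"
      using assms(2) by (simp add: frac_eq_eq mult.commute)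
    have "q ^ T n * q ^ T (n + 1 + r) = q ^ T r * q ^ ((n + 1) * (n + 1 + r))"
      by (simp only: B flip: power_add)
    then have B': "q ^ T (n + 1 + r) / q ^ ((n + 1) * (n + 1 + r)) = q ^ T r / q ^ T n"
      using assms(2) by (simp only: frac_eq_eq mult.commute power_not_zero simp_thms)
    have D: "(- (z / q ^ (n + 1))) ^ k = (- z) ^ k / q ^ ((n + 1) * k)" for k
      by (simp only: minus_divide_left power_divide power_mult)
    have "f (n - r) = (- z) ^ (n - r) * (q ^ T (n - r) / q ^ ((n + 1) * (n - r))) * qbinom q (2 * n + 1) (n - r)"
      unfolding f_def D by simp
    moreover have "f (n + 1 + r) = (- z) ^ (n + 1 + r) * (q ^ T (n + 1 + r) / q ^ ((n + 1) * (n + 1 + r)))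
        * qbinom q (2 * n + 1) (n - r)"
      unfolding f_def D s by simp
    moreover have "(- z) ^ (n - r) = (- z) ^ n * ((- 1) ^ r / z ^ r)"
      using assms(3) by (simp add: n power_add power_minus[of z])
    moreover have "(- z) ^ (n + 1 + r) = - ((- z) ^ n * ((- 1) ^ r * z ^ (r + 1)))"
      by (simp add: power_add power_minus[of z])
    ultimately show ?thesis
      unfolding A' B' using assms(3) by (simp add: algebra_simps)
  qed
  have "(\<Sum>k\<le>2 * n + 1. f k) = (\<Prod>i<n + (n + 1). 1 - z * q ^ i / q ^ n)"
    using q_binomial[OF assms(1), of "z / q ^ (n + 1)" "2 * n + 1"] assms(2)
    by (simp add: f_def qpoch_def mult_2)
  also have "\<dots> = (\<Prod>i<n. 1 - z * q ^ i / q ^ n) * qpoch z q (n + 1)"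
    using assms(2)
    unfolding qpoch_def prod_lessThan_add by (simp add: power_add del: prod.lessThan_Suc)
  also have "\<dots> = (- z) ^ n / q ^ T n * (qpoch z q (n + 1) * qpoch (q / z) q n)"
    using assms by (simp add: qpoch_reverse)
  finally have "(- z) ^ n / q ^ T n * (\<Sum>r\<le>n. (- 1) ^ r * q ^ T r * qbinom q (2 * n + 1) (n - r) *
      (1 / z ^ r - z ^ (r + 1))) = (- z) ^ n / q ^ T n * (qpoch z q (n + 1) * qpoch (q / z) q n)"
    unfolding sum_fold_odd sum_distrib_left using sum.cong[OF refl fold, of "{..n}"] by (simp only: atMost_iff)
  then show ?thesis
    using assms by (simp del: qpoch_Suc)
qed


section \<open>A Bailey pair relative to q\<close>

text \<open>The coefficients A_r: since (r + 1) div 2 = j for both r = 2j and r = 2j - 1, one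
  formula covers both parities.\<close>

definition bailey_alpha :: "complex \<Rightarrow> nat \<Rightarrow> complex" where
  "bailey_alpha q r = (- 1) ^ ((r + 1) div 2) * q ^ (2 * ((r + 1) div 2)\<^sup>2)"

theorem qpoch_minus_q_expansion:
  assumes "norm q < 1" "q \<noteq> 0"
  shows "qpoch (- q) (q ^ 2) n = (\<Sum>r\<le>n. bailey_alpha q r * qbinom q (2 * n + 1) (n - r))"
proof -
  \<comment> \<open>The product at \<open>w\<close> is the left-hand side times \<open>1 - w q ^ n\<close>; averaging over
    \<open>w\<close> and \<open>-w\<close> removes the extra factor and the odd powers of \<open>w\<close>.\<close>
  define w where "w = \<i> * csqrt q"
  have w2: "w ^ 2 = - q"
    by (simp add: w_def power_mult_distrib)
  have w0: "w \<noteq> 0"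
    using assms by (simp add: w_def)
  have m0: "- w \<noteq> 0"
    using w0 by simp
  \<comment> \<open>From u^2 = -q follows q/u = -u, and (1 - u q^i) (1 + u q^i) = 1 + q^(2i+1); the
    first product has one factor more, 1 - u q^n.\<close>
  have P: "qpoch u q (n + 1) * qpoch (q / u) q n = qpoch (- q) (q ^ 2) n * (1 - u * q ^ n)"
    if "u ^ 2 = - q" "u \<noteq> 0" for u
  proof -
    have "q / u = - u"
      using that by (simp add: divide_simps power2_eq_square)
    moreover have "qpoch u q n * qpoch (- u) q n = qpoch (- q) (q ^ 2) n"
      unfolding qpoch_def prod.distrib[symmetric] that(1)[symmetric]
      by (intro prod.cong) (simp_all add: algebra_simps power_mult_distrib power2_eq_square)
    ultimately show ?thesis by (simp add: algebra_simps)
  qed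
  have "2 * qpoch (- q) (q ^ 2) n
      = qpoch (- q) (q ^ 2) n * (1 - w * q ^ n) + qpoch (- q) (q ^ 2) n * (1 - (- w) * q ^ n)"
    by (simp add: algebra_simps)
  also have "\<dots> = qpoch w q (n + 1) * qpoch (q / w) q n + qpoch (- w) q (n + 1) * qpoch (q / (- w)) q n"
    using P[OF w2 w0] P[of "- w"] w2 w0 by (simp only: power2_minus neg_equal_0_iff_equal not_False_eq_True simp_thms)
  also have "\<dots> = (\<Sum>r\<le>n. (- 1) ^ r * q ^ T r * qbinom q (2 * n + 1) (n - r) *
      ((1 / w ^ r - w ^ (r + 1)) + (1 / (- w) ^ r - (- w) ^ (r + 1))))"
    unfolding finite_triple_product[OF assms w0] finite_triple_product[OF assms m0] distrib_left sum.distrib ..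
  also have "\<dots> = (\<Sum>r\<le>n. 2 * (bailey_alpha q r * qbinom q (2 * n + 1) (n - r)))"
  proof (rule sum.cong)
    fix r
    have "(- 1) ^ r * q ^ T r * ((1 / w ^ r - w ^ (r + 1)) + (1 / (- w) ^ r - (- w) ^ (r + 1)))
        = 2 * bailey_alpha q r"
    \<comment> \<open>For r = 2j the powers w^(r+1) cancel, leaving 2/w^(2j), and T r - j = 2 j^2.
      For r = 2j + 1 the terms 1/w^r cancel, leaving -2 w^(2j+2), and T r + (j+1) = 2
      (j+1)^2.\<close>
    proof (cases "even r")
      case True
      then obtain j where r: "r = 2 * j" by auto
      have "T r = 2 * j\<^sup>2 + j"
        using two_T[of r] by (simp add: r power2_eq_square algebra_simps)
      moreover have "w ^ r = (- 1) ^ j * q ^ j"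
        unfolding r power_mult w2 by (rule power_minus)
      ultimately show ?thesis
        using assms(2) True by (simp add: r bailey_alpha_def power_add field_simps)
    next
      case False
      then obtain j where r: "r = 2 * j + 1" by (auto elim: oddE)
      have "T r + (j + 1) = 2 * (j + 1)\<^sup>2"
        using two_T[of r] by (simp add: r power2_eq_square algebra_simps)
      then have "q ^ T r * q ^ (j + 1) = q ^ (2 * (j + 1)\<^sup>2)"
        by (metis power_add)
      moreover have "w ^ (r + 1) = (- 1) ^ (j + 1) * q ^ (j + 1)"
      proof -
        have "r + 1 = 2 * (j + 1)" by (simp add: r)
        then show ?thesis
          unfolding power_mult by (simp only: power_mult w2 power_minus[of q])
      qed
      moreover have "(r + 1) div 2 = j + 1"
        by (simp add: r)
      ultimately show ?thesis
        using False unfolding bailey_alpha_def by simp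
    qed
    then have "qbinom q (2 * n + 1) (n - r) * ((- 1) ^ r * q ^ T r *
        ((1 / w ^ r - w ^ (r + 1)) + (1 / (- w) ^ r - (- w) ^ (r + 1))))
        = qbinom q (2 * n + 1) (n - r) * (2 * bailey_alpha q r)"
      by (rule arg_cong)
    then show "(- 1) ^ r * q ^ T r * qbinom q (2 * n + 1) (n - r) *
      ((1 / w ^ r - w ^ (r + 1)) + (1 / (- w) ^ r - (- w) ^ (r + 1))) =
      2 * (bailey_alpha q r * qbinom q (2 * n + 1) (n - r))"
      by (simp only: mult_ac)
  qed simp
  finally show ?thesis
    by (simp flip: sum_distrib_left)
qed

section \<open>A q-Chu-Vandermonde summation\<close>

theorem finite_q_vandermonde:
  assumes "norm q < 1"
  shows "(\<Sum>s\<le>n. q ^ (s * (s + a)) * qbinom q n s / qpoch q q (s + a)) = 1 / qpoch q q (n + a)"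
proof (induction n arbitrary: a)
  case 0
  then show ?case using assms by simp
next
  case (Suc n)
  \<comment> \<open>Pascal's rule reduces \<open>(n + 1, a)\<close> to \<open>(n, a + 1)\<close>.\<close>
  define h where "h s = q ^ (s * (s + a) + s) * qbinom q n s / qpoch q q (s + a)" for s
  define g where "g s = q ^ (Suc s * (Suc s + a)) * qbinom q n s / qpoch q q (Suc s + a)" for s
  have "(\<Sum>s\<le>Suc n. q ^ (s * (s + a)) * qbinom q (Suc n) s / qpoch q q (s + a))
      = h 0 + (\<Sum>s\<le>n. h (Suc s) + g s)"
    using assms unfolding sum.atMost_Suc_shift
    by (intro arg_cong2[of _ _ _ _ "(+)"] sum.cong)
       (simp_all add: h_def g_def qbinom_Suc_Suc power_add algebra_simps add_divide_distrib)
  also have "\<dots> = (\<Sum>s\<le>Suc n. h s) + (\<Sum>s\<le>n. g s)"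
    unfolding sum.atMost_Suc_shift by (simp add: sum.distrib)
  \<comment> \<open>The extra term \<open>h (Suc n)\<close> vanishes because its binomial
    coefficient does.\<close>
  also have "\<dots> = (\<Sum>s\<le>n. h s + g s)"
    by (simp add: h_def sum.distrib)
  also have "\<dots> = (\<Sum>s\<le>n. q ^ (s * (s + Suc a)) * qbinom q n s / qpoch q q (s + Suc a))"
  proof (rule sum.cong)
    fix s
    \<comment> \<open>With c = s + a + 1, the two terms merge by 1 + q^c/(1 - q^c) = 1/(1 -
      q^c).\<close>
    have "q ^ (Suc s * (Suc s + a)) = q ^ (s * (s + Suc a)) * (q * q ^ (s + a))"
      by (simp add: power_add algebra_simps)
    moreover have "q ^ (s * (s + a) + s) = q ^ (s * (s + Suc a))"
      by (simp add: power_add algebra_simps)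
    moreover have "qpoch q q (s + a) \<noteq> 0" "1 - q * q ^ (s + a) \<noteq> 0"
      using qpoch_neq_0[OF assms] power_neq_1[OF assms, of "Suc _"] by auto
    ultimately show "h s + g s = q ^ (s * (s + Suc a)) * qbinom q n s / qpoch q q (s + Suc a)"
      unfolding h_def g_def by (simp add: divide_simps) (simp add: algebra_simps power_add)
  qed simp
  finally show ?case using Suc[of "Suc a"] by simp
qed

section \<open>Limits\<close>

lemma convergent_prod_qpoch:
  fixes q a :: complex
  assumes "norm q < 1"
  shows "convergent_prod (\<lambda>j. 1 - a * q ^ j)"
proof -
  have "summable (\<lambda>j. norm a * norm q ^ j)"
    using assms by (intro summable_mult summable_geometric) simp
  then show ?thesis
    by (intro abs_convergent_prod_imp_convergent_prod)
       (simp add: abs_convergent_prod_conv_summable norm_mult norm_power)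
qed

lemma qpoch_tendsto:
  assumes "norm q < 1"
  shows "qpoch a q \<longlonglongrightarrow> qpoch_inf a q"
proof (rule LIMSEQ_imp_Suc)
  show "(\<lambda>n. qpoch a q (Suc n)) \<longlonglongrightarrow> qpoch_inf a q"
    using convergent_prod_LIMSEQ[OF convergent_prod_qpoch[OF assms, of a]]
    unfolding qpoch_inf_def qpoch_def lessThan_Suc_atMost .
qed

lemma qpoch_inf_neq_0:
  assumes "norm q < 1"
  shows "qpoch_inf q q \<noteq> 0"
  unfolding qpoch_inf_def using power_neq_1[OF assms, of "Suc _"]
  by (intro prodinf_nonzero convergent_prod_qpoch assms) simp

lemma inverse_qpoch_bounded:
  assumes "norm q < 1"
  obtains C where "C > 0" "\<And>n. norm (1 / qpoch q q n) \<le> C"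
proof -
  have "(\<lambda>n. 1 / qpoch q q n) \<longlonglongrightarrow> 1 / qpoch_inf q q"
    by (intro tendsto_intros qpoch_tendsto qpoch_inf_neq_0 assms)
  then have "Bseq (\<lambda>n. 1 / qpoch q q n)"
    by (rule convergent_imp_Bseq[OF convergentI])
  then show ?thesis
    by (elim BseqE) (use that in blast)
qed

text \<open>A bound uniform in both indices, as needed for majorants independent of n:
  \<open>qpoch q q\<close> and its reciprocal both converge, so both are bounded.\<close>

lemma qbinom_bounded:
  assumes "norm q < 1"
  obtains C where "C > 0" "\<And>n k. norm (qbinom q n k) \<le> C"
proof -
  obtain C where C: "C > 0" "\<And>n. norm (1 / qpoch q q n) \<le> C"
    using inverse_qpoch_bounded[OF assms] by blast
  have "Bseq (qpoch q q)"
    by (rule convergent_imp_Bseq[OF convergentI[OF qpoch_tendsto[OF assms]]])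
  then obtain D where D: "D > 0" "\<And>n. norm (qpoch q q n) \<le> D"
    by (auto elim: BseqE)
  have "norm (qbinom q n k) \<le> D * (C * C)" for n k
  proof (cases "k \<le> n")
    case True
    then have "norm (qbinom q n k)
        = norm (qpoch q q n) * (norm (1 / qpoch q q k) * norm (1 / qpoch q q (n - k)))"
      by (simp add: qbinom_def norm_mult norm_divide)
    also have "\<dots> \<le> D * (C * C)"
      using C D by (intro mult_mono) (auto simp: less_imp_le)
    finally show ?thesis .
  qed (use C D in simp)
  with C(1) D(1) show ?thesis by (intro that[of "D * (C * C)"]) auto
qed

lemma qbinom_tendsto:
  assumes "norm q < 1"
  shows "(\<lambda>n. qbinom q n k) \<longlonglongrightarrow> 1 / qpoch q q k"
proof -
  have "(\<lambda>n. qpoch q q n / (qpoch q q k * qpoch q q (n - k))) \<longlonglongrightarrow>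
      qpoch_inf q q / (qpoch q q k * qpoch_inf q q)"
    using assms qpoch_tendsto[OF assms]
    by (intro tendsto_intros filterlim_compose[OF _ filterlim_minus_const_nat_at_top])
       (auto simp: qpoch_neq_0 qpoch_inf_neq_0)
  moreover have "eventually (\<lambda>n. qpoch q q n / (qpoch q q k * qpoch q q (n - k)) = qbinom q n k) sequentially"
    using eventually_ge_at_top[of k] by eventually_elim (simp add: qbinom_def)
  ultimately show ?thesis
    using assms by (simp add: qpoch_inf_neq_0 filterlim_cong)
qed

text \<open>Both lower indices n - r and n + r + 1 grow with n, so numerator and both denominators
  tend to (q)_inf.\<close>

lemma central_qbinom_tendsto:
  assumes "norm q < 1"
  shows "(\<lambda>n. qbinom q (2 * n + 1) (n - r)) \<longlonglongrightarrow> 1 / qpoch_inf q q"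
proof -
  have f1: "filterlim (\<lambda>n. 2 * n + 1 - (n - r)) at_top sequentially"
    by (rule filterlim_at_top_mono[OF filterlim_ident always_eventually]) arith
  have f2: "filterlim (\<lambda>n::nat. 2 * n + 1) at_top sequentially"
    by (rule filterlim_at_top_mono[OF filterlim_ident always_eventually]) arith
  have "(\<lambda>n. qpoch q q (2 * n + 1) / (qpoch q q (n - r) * qpoch q q (2 * n + 1 - (n - r)))) \<longlonglongrightarrow>
      qpoch_inf q q / (qpoch_inf q q * qpoch_inf q q)"
    using assms
    by (intro tendsto_intros filterlim_compose[OF qpoch_tendsto filterlim_minus_const_nat_at_top]
      filterlim_compose[OF qpoch_tendsto f1] filterlim_compose[OF qpoch_tendsto f2])
       (auto simp: qpoch_neq_0 qpoch_inf_neq_0)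
  then show ?thesis
    using assms by (simp add: qpoch_inf_neq_0 qbinom_def trans_le_add1 le_SucI le_diff_conv del: qpoch_Suc)
qed

section \<open>Passage from terminating identities to series\<close>

text \<open>Tannery's theorem for terminating sums: extension by zero beyond n makes each sum a
  series, dominated by \<open>M\<close> uniformly in n.\<close>

lemma sums_of_dominated_finite_sums:
  fixes a :: "nat \<Rightarrow> nat \<Rightarrow> complex"
  assumes "\<And>k. a k \<longlonglongrightarrow> b k" "\<And>k n. norm (a k n) \<le> M k" "summable M"
    and "\<And>k n. n < k \<Longrightarrow> a k n = 0" "(\<lambda>n. \<Sum>k\<le>n. a k n) \<longlonglongrightarrow> S"
  shows "b sums S" "summable (\<lambda>k. norm (b k))"
proof -
  have t: "summable (\<lambda>n. norm (b n))" "(\<lambda>n. suminf (\<lambda>k. a k n)) \<longlonglongrightarrow> suminf b"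
    using tannerys_theorem[OF assms(1) always_eventually assms(3)] assms(2) by auto
  show "summable (\<lambda>k. norm (b k))" by fact
  have "suminf (\<lambda>k. a k n) = (\<Sum>k\<le>n. a k n)" for n
    by (rule suminf_finite) (auto simp: assms(4))
  then have "suminf b = S"
    using t(2) assms(5) by (simp add: LIMSEQ_unique)
  then show "b sums S"
    using summable_norm_cancel[OF t(1)] by (simp add: sums_iff)
qed

text \<open>The ratio x^(r+1) y of consecutive terms tends to 0 for every y. Arbitrary y is
  essential, as it is used for both |z| and 1/|z|.\<close>

lemma summable_theta:
  fixes x y :: real
  assumes "0 \<le> x" "x < 1"
  shows "summable (\<lambda>r. x ^ T r * y ^ r)"
proof -
  have "(\<lambda>r. norm (x ^ Suc r * y)) \<longlonglongrightarrow> norm (0 * y)"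
    using assms by (intro tendsto_intros LIMSEQ_Suc LIMSEQ_power_zero) simp
  then have "eventually (\<lambda>r. norm (x ^ Suc r * y) < 1 / 2) sequentially"
    by (rule order_tendstoD) simp
  then obtain N where N: "\<And>r. r \<ge> N \<Longrightarrow> norm (x ^ Suc r * y) < 1 / 2"
    by (auto simp: eventually_sequentially)
  show ?thesis
  proof (rule summable_ratio_test[of "1 / 2" N])
    fix r assume "r \<ge> N"
    have "norm (x ^ T (Suc r) * y ^ Suc r) = norm (x ^ Suc r * y) * norm (x ^ T r * y ^ r)"
      by (simp add: power_add abs_mult)
    also have "\<dots> \<le> 1 / 2 * norm (x ^ T r * y ^ r)"
      by (intro mult_right_mono less_imp_le[OF N] \<open>r \<ge> N\<close>) simp
    finally show "norm (x ^ T (Suc r) * y ^ Suc r) \<le> 1 / 2 * norm (x ^ T r * y ^ r)" .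
  qed simp
qed

text \<open>The limit of \<open>finite_triple_product\<close>. The bilateral series over powers of z
  is folded by pairing the exponents -r and r + 1.\<close>

theorem jacobi_triple_product:
  assumes "norm q < 1" "q \<noteq> 0" "z \<noteq> 0"
  shows "(\<lambda>r. (- 1) ^ r * q ^ T r * (1 / z ^ r - z ^ (r + 1))) sums
    (qpoch_inf q q * qpoch_inf z q * qpoch_inf (q / z) q)"
proof -
  obtain C where C: "C > 0" "\<And>n k. norm (qbinom q n k) \<le> C"
    using qbinom_bounded[OF assms(1)] by blast
  define a where "a r n = (if r \<le> n then (- 1) ^ r * q ^ T r * qbinom q (2 * n + 1) (n - r) *
      (1 / z ^ r - z ^ (r + 1)) else 0)" for r n
  \<comment> \<open>\<open>C\<close> bounds the Gaussian coefficient; the two summands are theta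
    terms for 1/z and z.\<close>
  define M where "M r = C * (norm q ^ T r * (1 / norm z) ^ r + norm z * (norm q ^ T r * norm z ^ r))" for r
  have "(\<lambda>r. (- 1) ^ r * q ^ T r * (1 / qpoch_inf q q) * (1 / z ^ r - z ^ (r + 1))) sums
      (qpoch_inf z q * qpoch_inf (q / z) q)"
  proof (rule sums_of_dominated_finite_sums)
    show "summable M"
      unfolding M_def using assms
      by (intro summable_mult summable_add summable_theta) auto
    show "norm (a r n) \<le> M r" for r n
    proof (cases "r \<le> n")
      case True
      have "norm (1 / z ^ r - z ^ (r + 1)) \<le> (1 / norm z) ^ r + norm z * norm z ^ r"
        by (rule order_trans[OF norm_triangle_ineq4]) (simp add: norm_mult norm_divide norm_power power_divide)
      then have "norm (a r n) \<le> norm q ^ T r * C * ((1 / norm z) ^ r + norm z * norm z ^ r)"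
        using True C by (auto simp: a_def norm_mult norm_power intro!: mult_mono)
      then show ?thesis by (simp add: M_def algebra_simps)
    qed (use C in \<open>simp add: a_def M_def\<close>)
    show "a r \<longlonglongrightarrow> (- 1) ^ r * q ^ T r * (1 / qpoch_inf q q) * (1 / z ^ r - z ^ (r + 1))" for r
    proof -
      have "(\<lambda>n. (- 1) ^ r * q ^ T r * qbinom q (2 * n + 1) (n - r) * (1 / z ^ r - z ^ (r + 1)))
          \<longlonglongrightarrow> (- 1) ^ r * q ^ T r * (1 / qpoch_inf q q) * (1 / z ^ r - z ^ (r + 1))"
        by (intro tendsto_intros central_qbinom_tendsto assms)
      moreover have "eventually (\<lambda>n. (- 1) ^ r * q ^ T r * qbinom q (2 * n + 1) (n - r) *
          (1 / z ^ r - z ^ (r + 1)) = a r n) sequentially"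
        using eventually_ge_at_top[of r] by eventually_elim (simp add: a_def)
      ultimately show ?thesis by (rule Lim_transform_eventually)
    qed
    show "(\<lambda>n. \<Sum>r\<le>n. a r n) \<longlonglongrightarrow> qpoch_inf z q * qpoch_inf (q / z) q"
    proof -
      have "(\<Sum>r\<le>n. a r n) = qpoch z q (Suc n) * qpoch (q / z) q n" for n
        using finite_triple_product[OF assms, of n] by (simp add: a_def del: qpoch_Suc)
      then show ?thesis
        by (auto intro!: tendsto_mult qpoch_tendsto LIMSEQ_Suc assms simp del: qpoch_Suc)
    qed
  qed (simp add: a_def)
  from sums_mult[OF this, of "qpoch_inf q q"] show ?thesis
    using qpoch_inf_neq_0[OF assms(1)]
    by (simp add: mult.assoc)
qed

text \<open>The limit of \<open>finite_q_vandermonde\<close>, dominated by a geometric series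
  because s (s + a) \<ge> s. Absolute convergence is what yields an unordered sum later.\<close>

theorem q_vandermonde_limit:
  assumes "norm q < 1"
  shows "(\<lambda>s. q ^ (s * (s + a)) / (qpoch q q s * qpoch q q (s + a))) sums (1 / qpoch_inf q q)"
    and "summable (\<lambda>s. norm (q ^ (s * (s + a)) / (qpoch q q s * qpoch q q (s + a))))"
proof -
  obtain C where C: "C > 0" "\<And>n k. norm (qbinom q n k) \<le> C"
    using qbinom_bounded[OF assms(1)] by blast
  obtain D where D: "D > 0" "\<And>n. norm (1 / qpoch q q n) \<le> D"
    using inverse_qpoch_bounded[OF assms] by blast
  define f where "f s n = q ^ (s * (s + a)) * qbinom q n s / qpoch q q (s + a)" for s n
  define b where "b s = q ^ (s * (s + a)) / (qpoch q q s * qpoch q q (s + a))" for s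
  have 1: "f s \<longlonglongrightarrow> b s" for s
  proof -
    have "f s \<longlonglongrightarrow> q ^ (s * (s + a)) * (1 / qpoch q q s) / qpoch q q (s + a)"
      unfolding f_def by (intro tendsto_intros qbinom_tendsto assms qpoch_neq_0)
    then show ?thesis by (simp add: b_def)
  qed
  have 2: "norm (f s n) \<le> norm q ^ s * C * D" for s n
  proof -
    have "norm q ^ (s * (s + a)) \<le> norm q ^ s"
      using assms by (intro power_decreasing) (cases s, auto)
    then have "norm (q ^ (s * (s + a))) * norm (qbinom q n s) * norm (1 / qpoch q q (s + a))
        \<le> norm q ^ s * C * D"
      using C D by (intro mult_mono) (auto simp: norm_power less_imp_le)
    then show ?thesis by (simp add: f_def norm_mult norm_divide)
  qed
  have 3: "summable (\<lambda>s. norm q ^ s * C * D)"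
    using assms by (intro summable_mult2 summable_geometric) simp
  have 4: "(\<lambda>n. \<Sum>s\<le>n. f s n) \<longlonglongrightarrow> 1 / qpoch_inf q q"
    unfolding f_def finite_q_vandermonde[OF assms]
    by (intro tendsto_intros qpoch_inf_neq_0 assms LIMSEQ_ignore_initial_segment qpoch_tendsto)
  have 5: "f s n = 0" if "n < s" for s n
    using that by (simp add: f_def)
  show "b sums (1 / qpoch_inf q q)" "summable (\<lambda>s. norm (b s))"
    using sums_of_dominated_finite_sums[of f b, OF 1 2 3 5 4] by blast+
qed


section \<open>The triple series\<close>

lemma qpoch_minus_q_div:
  assumes "norm q < 1" "q \<noteq> 0"
  shows "qpoch (- q) (q ^ 2) k / qpoch q q (2 * k + 1)
    = (\<Sum>r\<le>k. bailey_alpha q r / (qpoch q q (k - r) * qpoch q q (k + r + 1)))"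
  unfolding qpoch_minus_q_expansion[OF assms] sum_divide_distrib
proof (rule sum.cong)
  fix r assume "r \<in> {..k}"
  then have "2 * k + 1 - (k - r) = k + r + 1" "k - r \<le> 2 * k + 1" by auto
  then show "bailey_alpha q r * qbinom q (2 * k + 1) (k - r) / qpoch q q (2 * k + 1)
      = bailey_alpha q r / (qpoch q q (k - r) * qpoch q q (k + r + 1))"
    using qpoch_neq_0[OF assms(1), of "2 * k + 1"] by (simp add: qbinom_def del: qpoch_Suc)
qed simp

text \<open>Since 2 T (r + s) = 2 T r + s (s + 2r + 1), this is the finite q-Vandermonde sum with a
  = 2r + 1.\<close>

lemma bailey_inner_sum:
  assumes "norm q < 1"
  shows "(\<Sum>s\<le>n. q ^ (2 * T (r + s)) / (qpoch q q (n - s) * qpoch q q s * qpoch q q (s + (2 * r + 1))))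
    = q ^ (2 * T r) / (qpoch q q n * qpoch q q (n + (2 * r + 1)))"
proof -
  have "q ^ (2 * T (r + s)) / (qpoch q q (n - s) * qpoch q q s * qpoch q q (s + (2 * r + 1)))
      = q ^ (2 * T r) / qpoch q q n * (q ^ (s * (s + (2 * r + 1))) * qbinom q n s / qpoch q q (s + (2 * r + 1)))"
    if "s \<le> n" for s
  proof -
    have "2 * T (r + s) = 2 * T r + s * (s + (2 * r + 1))"
      unfolding two_T by (simp add: algebra_simps)
    then show ?thesis
      using that qpoch_neq_0[OF assms, of n] by (simp add: qbinom_def power_add mult_ac del: qpoch_Suc)
  qed
  then have "(\<Sum>s\<le>n. q ^ (2 * T (r + s)) / (qpoch q q (n - s) * qpoch q q s * qpoch q q (s + (2 * r + 1))))
      = (\<Sum>s\<le>n. q ^ (2 * T r) / qpoch q q n *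
          (q ^ (s * (s + (2 * r + 1))) * qbinom q n s / qpoch q q (s + (2 * r + 1))))"
    by (intro sum.cong) auto
  also have "\<dots> = q ^ (2 * T r) / (qpoch q q n * qpoch q q (n + (2 * r + 1)))"
    unfolding sum_distrib_left[symmetric] finite_q_vandermonde[OF assms] by simp
  finally show ?thesis .
qed

lemma summable_on_geometric_product3:
  fixes x :: real
  assumes "0 \<le> x" "x < 1"
  shows "(\<lambda>(m, s, r). x ^ m * (x ^ s * x ^ r)) summable_on (UNIV :: (nat \<times> nat \<times> nat) set)"
proof -
  have g: "(\<lambda>n. x ^ n) summable_on UNIV"
    using assms by (intro norm_summable_imp_summable_on) (simp add: summable_geometric)
  \<comment> \<open>The type of \<open>y\<close> stays polymorphic: the fact is used once for the
    pair (s, r) and once for r alone.\<close>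
  have prod: "(\<lambda>(m, y). x ^ m * f y) summable_on (UNIV :: (nat \<times> 'b) set)"
    if "f summable_on UNIV" "\<And>y. f y \<ge> 0" for f :: "'b \<Rightarrow> real"
    unfolding UNIV_Times_UNIV[symmetric]
    using that assms
    by (intro summable_on_SigmaI[where g = "\<lambda>m. x ^ m * infsum f UNIV"]
          summable_on_cmult_left g) (auto intro!: has_sum_cmult_right has_sum_infsum)
  have "(\<lambda>(m, y). x ^ m * (case y of (s, r) \<Rightarrow> x ^ s * x ^ r)) summable_on (UNIV :: (nat \<times> nat \<times> nat) set)"
    using assms by (intro prod g) auto
  then show ?thesis by (simp add: case_prod_unfold)
qed

lemma norm_bailey_alpha_le_1:
  assumes "norm q < 1"
  shows "norm (bailey_alpha q r) \<le> 1"
  using assms by (simp add: bailey_alpha_def norm_mult norm_power power_le_one)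

text \<open>The summation indices of the double series are \<open>m\<close> and \<open>k = r + s\<close>.\<close>

definition triple_term :: "complex \<Rightarrow> nat \<times> nat \<times> nat \<Rightarrow> complex" where
  "triple_term q = (\<lambda>(m, s, r). bailey_alpha q r * q ^ (2 * T (r + s) + 2 * T (m + (r + s)))
     / (qpoch q q m * qpoch q q s * qpoch q q (s + (2 * r + 1))))"

text \<open>The exponent of q is at least m + s + r because T n \<ge> n, and the reciprocals are
  bounded. This licenses both regroupings of the triple series.\<close>

lemma triple_term_summable:
  assumes "norm q < 1"
  shows "triple_term q summable_on UNIV"
proof -
  obtain D where D: "D > 0" "\<And>n. norm (1 / qpoch q q n) \<le> D"
    using inverse_qpoch_bounded[OF assms] by blast
  have "norm (triple_term q (m, s, r)) \<le> D * D * D * (norm q ^ m * (norm q ^ s * norm q ^ r))" for m s r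
  proof -
    have "m + (s + r) \<le> 2 * T (r + s) + 2 * T (m + (r + s))"
      using T_ge[of "m + (r + s)"] by simp
    then have e: "norm q ^ (2 * T (r + s) + 2 * T (m + (r + s))) \<le> norm q ^ (m + (s + r))"
      using assms by (intro power_decreasing) auto
    have "norm (triple_term q (m, s, r))
        = norm (bailey_alpha q r) * norm q ^ (2 * T (r + s) + 2 * T (m + (r + s)))
          * (norm (1 / qpoch q q m) * norm (1 / qpoch q q s) * norm (1 / qpoch q q (s + (2 * r + 1))))"
      by (simp add: triple_term_def norm_mult norm_divide norm_power del: qpoch_Suc)
    also have "\<dots> \<le> 1 * norm q ^ (m + (s + r)) * (D * D * D)"
      using D by (intro mult_mono e norm_bailey_alpha_le_1 assms) (auto simp: less_imp_le simp del: qpoch_Suc)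
    finally show ?thesis by (simp add: power_add mult_ac)
  qed
  then have "(\<lambda>x. norm (triple_term q x)) summable_on UNIV"
    by (intro Infinite_Sum.abs_summable_on_comparison_test'[OF summable_on_cmult_right[OF
          summable_on_geometric_product3[of "norm q"]], of _ "D * D * D"])
       (use assms in auto)
  then show ?thesis by (rule abs_summable_summable)
qed

text \<open>Grouping by k = r + s undoes the Bailey expansion and recovers the summand of the double
  series.\<close>

lemma triple_term_sum_over_r:
  assumes "norm q < 1" "q \<noteq> 0"
  shows "(\<Sum>r\<le>k. triple_term q (m, k - r, r)) =
    q ^ (2 * T k + 2 * T (m + k)) / (qpoch q q m * qpoch q q (2 * k + 1)) * qpoch (- q) (q ^ 2) k"
proof -
  have "triple_term q (m, k - r, r) = q ^ (2 * T k + 2 * T (m + k)) / qpoch q q m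
      * (bailey_alpha q r / (qpoch q q (k - r) * qpoch q q (k + r + 1)))" if "r \<le> k" for r
  proof -
    have "k - r + (2 * r + 1) = k + r + 1" "r + (k - r) = k" using that by auto
    then show ?thesis unfolding triple_term_def prod.case by (simp add: ac_simps)
  qed
  then have "(\<Sum>r\<le>k. triple_term q (m, k - r, r)) = (\<Sum>r\<le>k. q ^ (2 * T k + 2 * T (m + k)) / qpoch q q m
      * (bailey_alpha q r / (qpoch q q (k - r) * qpoch q q (k + r + 1))))"
    by (intro sum.cong) auto
  also have "\<dots> = q ^ (2 * T k + 2 * T (m + k)) / qpoch q q m *
      (qpoch (- q) (q ^ 2) k / qpoch q q (2 * k + 1))"
    unfolding qpoch_minus_q_div[OF assms] sum_distrib_left ..
  finally show ?thesis by simp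
qed

text \<open>With n = m + s fixed, T (m + k) = T (n + r) does not involve s. The surviving exponent 4
  T r + n (n + 2r + 1) has the shape needed for a second q-Vandermonde sum, over n.\<close>

lemma triple_term_sum_over_s:
  assumes "norm q < 1"
  shows "(\<Sum>s\<le>n. triple_term q (n - s, s, r)) = bailey_alpha q r * q ^ (4 * T r) *
    (q ^ (n * (n + (2 * r + 1))) / (qpoch q q n * qpoch q q (n + (2 * r + 1))))"
proof -
  have "triple_term q (n - s, s, r) = bailey_alpha q r * q ^ (2 * T (n + r)) *
      (q ^ (2 * T (r + s)) / (qpoch q q (n - s) * qpoch q q s * qpoch q q (s + (2 * r + 1))))"
    if "s \<le> n" for s
  proof -
    have "n - s + (r + s) = n + r" using that by auto
    then show ?thesis unfolding triple_term_def prod.case by (simp add: power_add del: qpoch_Suc)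
  qed
  then have "(\<Sum>s\<le>n. triple_term q (n - s, s, r)) = (\<Sum>s\<le>n. bailey_alpha q r * q ^ (2 * T (n + r)) *
      (q ^ (2 * T (r + s)) / (qpoch q q (n - s) * qpoch q q s * qpoch q q (s + (2 * r + 1)))))"
    by (intro sum.cong) auto
  also have "\<dots> = bailey_alpha q r * (q ^ (2 * T (n + r)) * q ^ (2 * T r)) /
      (qpoch q q n * qpoch q q (n + (2 * r + 1)))"
    unfolding sum_distrib_left[symmetric] bailey_inner_sum[OF assms] by simp
  also have "q ^ (2 * T (n + r)) * q ^ (2 * T r) = q ^ (4 * T r) * q ^ (n * (n + (2 * r + 1)))"
  proof -
    have "2 * T (n + r) + 2 * T r = 4 * T r + n * (n + (2 * r + 1))"
      using two_T[of r] two_T[of "n + r"] by (simp add: algebra_simps)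
    then show ?thesis by (metis power_add)
  qed
  finally show ?thesis by simp
qed

section \<open>The theta series and the final evaluation\<close>

text \<open>The terms r = 2j and r = 2j + 1 have exponents 20 T j - 6j and 20 T j + 6 (j + 1) and
  opposite signs: together they form the j-th term of the triple product in base q^20 at z =
  q^6.\<close>

lemma bailey_alpha_series:
  assumes "norm q < 1" "q \<noteq> 0"
    and "(\<lambda>r. bailey_alpha q r * q ^ (4 * T r) * c) sums X"
  shows "X = qpoch_inf (q ^ 20) (q ^ 20) * qpoch_inf (q ^ 6) (q ^ 20) * qpoch_inf (q ^ 14) (q ^ 20) * c"
proof -
  have "norm (q ^ 20) < 1"
    using assms(1) by (simp add: norm_power power_less_one_iff)
  moreover have "q ^ 20 / q ^ 6 = q ^ 14"
    using assms(2) by (simp add: field_simps flip: power_add)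
  ultimately have J: "(\<lambda>r. (- 1) ^ r * (q ^ 20) ^ T r * (1 / (q ^ 6) ^ r - (q ^ 6) ^ (r + 1)) * c) sums
      (qpoch_inf (q ^ 20) (q ^ 20) * qpoch_inf (q ^ 6) (q ^ 20) * qpoch_inf (q ^ 14) (q ^ 20) * c)"
    using jacobi_triple_product[of "q ^ 20" "q ^ 6"] assms(2) by (intro sums_mult2) auto
  have t: "bailey_alpha q (2 * j) * q ^ (4 * T (2 * j)) + bailey_alpha q (2 * j + 1) * q ^ (4 * T (2 * j + 1))
      = (- 1) ^ j * (q ^ 20) ^ T j * (1 / (q ^ 6) ^ j - (q ^ 6) ^ (j + 1))" for j
  proof -
    have a: "2 * j\<^sup>2 + 4 * T (2 * j) + 6 * j = 20 * T j"
      using two_T[of j] two_T[of "2 * j"] by (simp add: power2_eq_square algebra_simps)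
    have b: "2 * (j + 1)\<^sup>2 + 4 * T (2 * j + 1) = 20 * T j + 6 * (j + 1)"
      using two_T[of j] two_T[of "2 * j + 1"] by (simp add: power2_eq_square algebra_simps)
    have "q ^ (2 * j\<^sup>2) * q ^ (4 * T (2 * j)) * (q ^ 6) ^ j = (q ^ 20) ^ T j"
      using a by (simp flip: power_add power_mult)
    then have a': "q ^ (2 * j\<^sup>2) * q ^ (4 * T (2 * j)) = (q ^ 20) ^ T j / (q ^ 6) ^ j"
      using assms(2) by (simp add: field_simps)
    have b': "q ^ (2 * (j + 1)\<^sup>2) * q ^ (4 * T (2 * j + 1)) = (q ^ 20) ^ T j * (q ^ 6) ^ (j + 1)"
      by (simp only: b flip: power_add power_mult)
    have "bailey_alpha q (2 * j) = (- 1) ^ j * q ^ (2 * j\<^sup>2)"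
      by (simp add: bailey_alpha_def)
    moreover have "bailey_alpha q (2 * j + 1) = - ((- 1) ^ j * q ^ (2 * (j + 1)\<^sup>2))"
      by (simp add: bailey_alpha_def)
    ultimately have "bailey_alpha q (2 * j) * q ^ (4 * T (2 * j)) + bailey_alpha q (2 * j + 1) * q ^ (4 * T (2 * j + 1))
        = (- 1) ^ j * (q ^ (2 * j\<^sup>2) * q ^ (4 * T (2 * j)))
          - (- 1) ^ j * (q ^ (2 * (j + 1)\<^sup>2) * q ^ (4 * T (2 * j + 1)))"
      by (simp only: mult.assoc) simp
    then show ?thesis unfolding a' b' by (simp add: algebra_simps)
  qed
  have "{j * 2..<j * 2 + 2} = {2 * j, 2 * j + 1}" for j :: nat by auto
  then have "(\<lambda>j. (bailey_alpha q (2 * j) * q ^ (4 * T (2 * j))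
      + bailey_alpha q (2 * j + 1) * q ^ (4 * T (2 * j + 1))) * c) sums X"
    using sums_group[OF assms(3), of 2] by (simp add: distrib_right del: T_Suc)
  then show ?thesis
    unfolding t using J by (rule sums_unique2)
qed

text \<open>The case q = 0 is separate because the triple products divide by powers of q. Only (m,
  k) = (0, 0) contributes, through 0^0 = 1.\<close>

lemma double_sum_at_0:
  "((\<lambda>(m, k). 0 ^ (2 * T k + 2 * T (m + k)) / (qpoch 0 0 m * qpoch 0 0 (2 * k + 1))
      * qpoch (- 0) (0 ^ 2) k) has_sum 1) (UNIV :: (nat \<times> nat) set)"
proof -
  have T0: "T n = 0 \<longleftrightarrow> n = 0" for n
    using T_ge[of n] by auto
  have "((\<lambda>(m, k). 0 ^ (2 * T k + 2 * T (m + k)) / (qpoch 0 0 m * qpoch 0 0 (2 * k + 1))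
      * qpoch (- 0) (0 ^ 2) k) has_sum 1) {(0, 0)}"
    by (simp add: has_sum_finite_iff)
  then show ?thesis
    by (subst has_sum_cong_neutral[where T = "{(0, 0)}"]) (auto simp: T0)
qed

theorem mainTheorem11:
  fixes q :: complex
  assumes "norm q < 1"
  shows "((\<lambda>(m, k). q ^ (2 * T k + 2 * T (m + k)) / (qpoch q q m * qpoch q q (2 * k + 1))
              * qpoch (- q) (q ^ 2) k)
          has_sum
            qpoch_inf_list [q ^ 20, q ^ 6, q ^ 14] (q ^ 20) / qpoch_inf q q)
         (UNIV :: (nat \<times> nat) set)"
proof (cases "q = 0")
  case True
  then show ?thesis
    using double_sum_at_0 by (simp add: qpoch_inf_list_def qpoch_inf_def)
next
  case False
  define X where "X = infsum (triple_term q) UNIV"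
  have X: "(triple_term q has_sum X) UNIV"
    unfolding X_def by (intro has_sum_infsum triple_term_summable assms)
  \<comment> \<open>First grouping: s = k - r. The fibre r \<le> k keeps the subtraction
    exact.\<close>
  have "((\<lambda>((m, k), r). triple_term q (m, k - r, r)) has_sum X) (SIGMA (m, k):UNIV. {..k})"
    using X by (subst has_sum_reindex_bij_witness[where T = UNIV and i = "\<lambda>(m, s, r). ((m, r + s), r)"
        and j = "\<lambda>((m, k), r). (m, k - r, r)" and h = "triple_term q" and s' = X]) auto
  then have lhs: "((\<lambda>(m, k). q ^ (2 * T k + 2 * T (m + k)) / (qpoch q q m * qpoch q q (2 * k + 1))
              * qpoch (- q) (q ^ 2) k) has_sum X) UNIV"
    by (rule has_sum_SigmaD)
       (auto simp: has_sum_finite_iff triple_term_sum_over_r[OF assms False] simp del: qpoch_Suc T_Suc)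
  \<comment> \<open>Second grouping of the same sum: m = n - s with s \<le> n.\<close>
  have "((\<lambda>((r, n), s). triple_term q (n - s, s, r)) has_sum X) (SIGMA (r, n):UNIV. {..n})"
    using X by (subst has_sum_reindex_bij_witness[where T = UNIV and i = "\<lambda>(m, s, r). ((r, m + s), s)"
        and j = "\<lambda>((r, n), s). (n - s, s, r)" and h = "triple_term q" and s' = X]) auto
  then have "((\<lambda>(r, n). bailey_alpha q r * q ^ (4 * T r) *
      (q ^ (n * (n + (2 * r + 1))) / (qpoch q q n * qpoch q q (n + (2 * r + 1))))) has_sum X) UNIV"
    by (rule has_sum_SigmaD)
       (auto simp: has_sum_finite_iff triple_term_sum_over_s[OF assms] simp del: qpoch_Suc T_Suc)
  \<comment> \<open>For fixed r, the sum over n is \<open>q_vandermonde_limit\<close> with a = 2r +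
    1.\<close>
  then have "((\<lambda>r. bailey_alpha q r * q ^ (4 * T r) * (1 / qpoch_inf q q)) has_sum X) UNIV"
    unfolding UNIV_Times_UNIV[symmetric]
    by (rule has_sum_SigmaD)
       (simp only: prod.case, intro has_sum_cmult_right norm_summable_imp_has_sum q_vandermonde_limit assms)
  then have "X = qpoch_inf (q ^ 20) (q ^ 20) * qpoch_inf (q ^ 6) (q ^ 20) * qpoch_inf (q ^ 14) (q ^ 20)
      * (1 / qpoch_inf q q)"
    by (intro bailey_alpha_series assms False has_sum_imp_sums)
  then show ?thesis
    using lhs by (simp add: qpoch_inf_list_def mult.assoc)
qed

end
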